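(* Let $\alpha=\alpha_R+\mathrm{i}\,\alpha_I\in\mathbb{C}$ with $\alpha_R,\alpha_I\in\mathbb{R}$, $\alpha\neq 0$ and $\alpha\notin\{z\in\mathbb{R}: z<0\}$, and let $\gamma>0$. Let $$\mathbf{A}=\mathbf{I}-\alpha\,\mathbf{L}_v\mathbf{L}_u,\qquad \mathbf{B}=\mathbf{I}-\gamma\,\mathbf{L}_v^{f}\mathbf{L}_u^{f},\qquad \widetilde{\mathbf{A}}=\mathbf{B}^{-1/2}\mathbf{A}\,\mathbf{B}^{-1/2}.$$ For $\zeta\in\mathbb{C}$ put $\Gamma^e_\zeta=1+\zeta\|\mathbf{L}_u^{c}\|^2$ and $\Gamma^i_\zeta=1+\zeta\|\mathbf{L}_u^{f}\|^2$, and define $$Q=\mathrm{conv}\Bigl\{1,\ \Gamma^e_\alpha,\ \tfrac{\alpha}{\gamma},\ \tfrac{\alpha}{\gamma}\Gamma^e_\gamma\Bigr\},$$ $$R=\mathrm{conv}\Bigl\{1,\ \Gamma^e_\gamma,\ 1+\bigl(\tfrac{\alpha}{\gamma}-1\bigr)\bigl(\Gamma^e_\gamma-\tfrac{1}{\Gamma^i_\gamma}\bigr),\ \Gamma^e_\gamma+\bigl(\tfrac{\alpha}{\gamma}-1\bigr)\bigl(\Gamma^e_\gamma-\tfrac{1}{\Gamma^i_\gamma}\bigr)\Bigr\},$$ where $\mathrm{conv}$ denotes the convex hull in $\mathbb{C}$. Then $\mathcal{F}(\widetilde{\mathbf{A}})\subset\mathcal{S}$, where $$\mathcal{S}=\begin{cases}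 Q\cap R, & \alpha_I\neq 0,\\ [\tfrac{\alpha}{\gamma},\,\Gamma^e_\alpha], & \alpha_I=0,\ 0<\alpha_R=\alpha\le\gamma,\\ [1,\,\tfrac{\alpha}{\gamma}\Gamma^e_\gamma], & \alpha_I=0,\ 0<\gamma\le\alpha_R=\alpha,\end{cases}$$ is independent of the fine mesh and $0\notin\mathcal{S}$.
   Context: Setting (spatially discretized two-field linear Friedrichs system on a locally refined mesh consisting of a few fine and many coarse elements, central-flux discontinuous Galerkin discretization). $\mathbf{M}_u\in\mathbb{R}^{N_u\times N_u}$ and $\mathbf{M}_v\in\mathbb{R}^{N_v\times N_v}$ are symmetric positive definite (mass matrices). They define weighted inner products $(\mathbf{x},\mathbf{y})_\Omega=\mathbf{x}^*\mathbf{M}_w\mathbf{y}$ on $\mathbb{C}^{N_w}$, $w\in\{u,v\}$, with induced norms $\|\cdot\|_\Omega$; which of the two is meant is clear from the argument. For a matrix $\mathbf{K}\in\mathbb{C}^{N_v\times N_u}$, $\|\mathbf{K}\|=\sup_{\mathbf{x}\neq 0}\|\mathbf{K}\mathbf{x}\|_\Omega/\|\mathbf{x}\|_\Omega$ is the operator norm with respect to the weighted norms. $\mathbf{I}$ is the $N_u\times N_u$ identity. $\mathbf{L}_u\in\mathbb{R}^{N_v\times N_u}$ and $\mathbf{L}_v\in\mathbb{R}^{N_u\times N_v}$ are the discrete Friedrichs matrices, split as $\mathbf{L}_u=\mathbf{L}_u^{f}+\mathbf{L}_u^{c}$, $\mathbf{L}_v=\mathbf{L}_v^{f}+\mathbf{L}_v^{c}$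 (real matrices), where $f$ refers to the part acting on the fine mesh elements (and their direct coarse neighbours) and $c$ to the remaining coarse part. The norms of $\mathbf{L}_u^{c}$ and $\mathbf{L}_v^{c}$ are bounded by $c\,h_c^{-1}$, where $h_c$ is the size of the smallest coarse element and $c$ is independent of the fine and coarse mesh sizes. The following properties hold, for all $\mathbf{u}\in\mathbb{C}^{N_u}$, $\mathbf{v}\in\mathbb{C}^{N_v}$: - adjointness: $(\mathbf{L}_u\mathbf{u},\mathbf{v})_\Omega=-(\mathbf{u},\mathbf{L}_v\mathbf{v})_\Omega$, and likewise $(\mathbf{L}_u^{c}\mathbf{u},\mathbf{v})_\Omega=-(\mathbf{u},\mathbf{L}_v^{c}\mathbf{v})_\Omega$, $(\mathbf{L}_u^{f}\mathbf{u},\mathbf{v})_\Omega=-(\mathbf{u},\mathbf{L}_v^{f}\mathbf{v})_\Omega$; - split products: $\mathbf{L}_v^{c}\mathbf{L}_u^{c}=\mathbf{L}_v^{c}\mathbf{L}_u$ and $\mathbf{L}_v^{f}\mathbf{L}_u^{f}=\mathbf{L}_v^{f}\mathbf{L}_u$; - consequently $\|\mathbf{L}_u\mathbf{u}\|_\Omega^2=\|\mathbf{L}_u^{c}\mathbf{u}\|_\Omega^2+\|\mathbf{L}_u^{f}\mathbf{u}\|_\Omega^2$. The matrix $\mathbf{B}$ is symmetric positive definite with respect to $(\cdot,\cdot)_\Omega$; $\mathbf{B}^{1/2}$ denotes its positive definite square root (symmetric w.r.t. $(\cdot,\cdot)_\Omega$) and $\mathbf{B}^{-1/2}$ the inverse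 of it. The field of values of $\mathbf{K}\in\mathbb{C}^{N_u\times N_u}$ is taken with respect to the weighted inner product: $\mathcal{F}(\mathbf{K})=\{(\mathbf{u},\mathbf{K}\mathbf{u})_\Omega/(\mathbf{u},\mathbf{u})_\Omega:\ \mathbf{u}\in\mathbb{C}^{N_u},\ \mathbf{u}\neq 0\}$.
   Formalization: For non-real α, S depends on the fine part's norm through R, so "independent of the fine mesh" is stated as: all such S lie in one convex compact set avoiding 0 determined by α, γ and the bound c/h_c; for real α, S is literally independent of the fine part's norm. *)

theory Defs
  imports "HOL-Analysis.Analysis"
begin

definition cmat :: "real^'n^'m \<Rightarrow> complex^'n^'m" where
  "cmat = map_matrix complex_of_real"

definition spd :: "real^'n^'n \<Rightarrow> bool" where
  "spd M \<longleftrightarrow> transpose M = M \<and> (\<forall>x. x \<noteq> 0 \<longrightarrow> 0 < x \<bullet> (M *v x))"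

(* x^* M y: conjugate-linear in the first argument *)
definition wip :: "real^'n^'n \<Rightarrow> complex^'n \<Rightarrow> complex^'n \<Rightarrow> complex" where
  "wip M x y = (\<Sum>i\<in>UNIV. cnj (x $ i) * (cmat M *v y) $ i)"

definition wnorm :: "real^'n^'n \<Rightarrow> complex^'n \<Rightarrow> real" where
  "wnorm M x = sqrt (Re (wip M x x))"

definition opnorm :: "real^'n^'n \<Rightarrow> real^'m^'m \<Rightarrow> complex^'n^'m \<Rightarrow> real" where
  "opnorm Mu Mv K = Sup {wnorm Mv (K *v x) / wnorm Mu x | x. x \<noteq> 0}"

definition field_of_values :: "real^'n^'n \<Rightarrow> complex^'n^'n \<Rightarrow> complex set" where
  "field_of_values M K = {wip M x (K *v x) / wip M x x | x. x \<noteq> 0}"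

(* X is symmetric positive definite with respect to wip M *)
definition wspd :: "real^'n^'n \<Rightarrow> complex^'n^'n \<Rightarrow> bool" where
  "wspd M X \<longleftrightarrow> (\<forall>x y. wip M (X *v x) y = wip M x (X *v y)) \<and>
     (\<forall>x. x \<noteq> 0 \<longrightarrow> 0 < Re (wip M x (X *v x)))"

definition is_pd_sqrt :: "real^'n^'n \<Rightarrow> complex^'n^'n \<Rightarrow> complex^'n^'n \<Rightarrow> bool" where
  "is_pd_sqrt M X B \<longleftrightarrow> wspd M X \<and> X ** X = B"

(* In the definitions below lc and lf stand for the operator norms of the
   coarse part and of the fine part of L_u. *)

definition Gam :: "complex \<Rightarrow> real \<Rightarrow> complex" where
  "Gam \<zeta> l = 1 + \<zeta> * (complex_of_real l)\<^sup>2"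

definition region_Q :: "complex \<Rightarrow> real \<Rightarrow> real \<Rightarrow> complex set" where
  "region_Q \<alpha> \<gamma> lc = convex hull
     {1, Gam \<alpha> lc, \<alpha> / of_real \<gamma>, \<alpha> / of_real \<gamma> * Gam (of_real \<gamma>) lc}"

definition region_R :: "complex \<Rightarrow> real \<Rightarrow> real \<Rightarrow> real \<Rightarrow> complex set" where
  "region_R \<alpha> \<gamma> lc lf = convex hull
     {1,
      Gam (of_real \<gamma>) lc,
      1 + (\<alpha> / of_real \<gamma> - 1) * (Gam (of_real \<gamma>) lc - 1 / Gam (of_real \<gamma>) lf),
      Gam (of_real \<gamma>) lc + (\<alpha> / of_real \<gamma> - 1) * (Gam (of_real \<gamma>) lc - 1 / Gam (of_real \<gamma>) lf)}"

(* The last two branches are real intervals with left end point <= right end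
   point when Re \<alpha> > 0; for \<alpha> = \<gamma> both give the same interval. *)
definition region_S :: "complex \<Rightarrow> real \<Rightarrow> real \<Rightarrow> real \<Rightarrow> complex set" where
  "region_S \<alpha> \<gamma> lc lf =
     (if Im \<alpha> \<noteq> 0 then region_Q \<alpha> \<gamma> lc \<inter> region_R \<alpha> \<gamma> lc lf
      else if Re \<alpha> \<le> \<gamma> then closed_segment (\<alpha> / of_real \<gamma>) (Gam \<alpha> lc)
      else closed_segment 1 (\<alpha> / of_real \<gamma> * Gam (of_real \<gamma>) lc))"

(* The fine mesh enters region_S only through lf, and the coarse part satisfies
   lc <= \<kappa> with \<kappa> independent of the fine mesh.  For real \<alpha> the region does not
   depend on lf at all.  For non-real \<alpha> the set R contains lf, and independence
   means that all the regions lie in one convex compact set avoiding 0 that is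
   determined by \<alpha>, \<gamma> and \<kappa> alone. *)
definition fine_mesh_independent :: "complex \<Rightarrow> real \<Rightarrow> real \<Rightarrow> bool" where
  "fine_mesh_independent \<alpha> \<gamma> \<kappa> \<longleftrightarrow>
     (Im \<alpha> = 0 \<longrightarrow> (\<forall>lc lf lf'. region_S \<alpha> \<gamma> lc lf = region_S \<alpha> \<gamma> lc lf')) \<and>
     (\<exists>T. convex T \<and> compact T \<and> 0 \<notin> T \<and>
        (\<forall>lc lf. 0 \<le> lc \<and> lc \<le> \<kappa> \<and> 0 \<le> lf \<longrightarrow> region_S \<alpha> \<gamma> lc lf \<subseteq> T))"

end

theory Submission
  imports Defs
begin

text \<open>
  With \<open>x = B\<^sup>1\<^sup>/\<^sup>2 y\<close>, \<open>a = \<parallel>L\<^sub>u\<^sup>c y\<parallel>\<^sup>2 / \<parallel>y\<parallel>\<^sup>2\<close> and \<open>b = \<parallel>L\<^sub>u\<^sup>f y\<parallel>\<^sup>2 / \<parallel>y\<parallel>\<^sup>2\<close>, the Rayleigh quotient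
  of the preconditioned matrix at \<open>x\<close> is \<open>(1 + \<alpha> (a + b)) / (1 + \<gamma> b)\<close>. Writing
  \<open>t = 1 / (1 + \<gamma> b)\<close>, this equals both \<open>1 + (1 - t) (\<alpha>/\<gamma> - 1) + t a \<alpha>\<close> and
  \<open>1 + (1 - t + \<gamma> t a) (\<alpha>/\<gamma> - 1) + \<gamma> t a\<close>, which exhibits it as a point of the parallelograms
  \<open>Q\<close> and \<open>R\<close>. Every branch of \<open>S\<close> lies in \<open>Q\<close>, which grows with the norm of the coarse part, and
  \<open>Q\<close> is contained in the open half plane around the direction \<open>\<surd>\<alpha>\<close>, hence avoids \<open>0\<close>.
\<close>

section \<open>Complexified matrices and weighted inner products\<close>

lemma cmat_add: "cmat (A + B) = cmat A + cmat B"
  by (simp add: cmat_def map_matrix_def vec_eq_iff)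

lemma cmat_mult: "cmat (A ** B) = cmat A ** cmat B"
  by (simp add: cmat_def map_matrix_def vec_eq_iff matrix_matrix_mult_def)

lemma mat_vector_mult: "mat k *v x = k *s (x :: 'a::comm_semiring_1^'n)"
  by (simp add: mat_def matrix_vector_mult_def vec_eq_iff if_distrib[of "\<lambda>c. c * _"] cong: if_cong)

lemma wip_add_right: "wip M x (y + z) = wip M x y + wip M x z"
  by (simp add: wip_def matrix_vector_right_distrib algebra_simps sum.distrib)

lemma wip_scale_right: "wip M x (k *s y) = k * wip M x y"
  by (simp add: wip_def vector_scalar_commute sum_distrib_left algebra_simps)

lemma wip_diff_right: "wip M x (y - z) = wip M x y - wip M x z"
  using wip_add_right[of M x "y - z" z] by simp

text \<open>Symmetry makes the cross terms between real and imaginary parts cancel, which leaves two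
  real quadratic forms.\<close>

lemma wip_self:
  assumes "transpose M = M"
  shows "wip M x x = of_real
    ((\<chi> i. Re (x $ i)) \<bullet> (M *v (\<chi> i. Re (x $ i))) + (\<chi> i. Im (x $ i)) \<bullet> (M *v (\<chi> i. Im (x $ i))))"
proof -
  let ?p = "\<chi> i. Re (x $ i)" and ?q = "\<chi> i. Im (x $ i)"
  have c: "(cmat M *v x) $ i = Complex ((M *v ?p) $ i) ((M *v ?q) $ i)" for i
    by (simp add: complex_eq_iff cmat_def map_matrix_def matrix_vector_mult_def)
  have s: "?p \<bullet> (M *v ?q) = ?q \<bullet> (M *v ?p)"
    by (metis assms dot_lmul_matrix inner_commute vector_transpose_matrix)
  show ?thesis
    using s by (simp add: complex_eq_iff wip_def c inner_vec_def sum.distrib sum_subtractf)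
qed

lemma wip_self_eq_wnorm:
  assumes "spd M"
  shows "wip M x x = of_real ((wnorm M x)\<^sup>2)"
proof -
  have "0 \<le> y \<bullet> (M *v y)" for y
    using assms by (cases "y = 0") (auto simp: spd_def less_imp_le)
  then show ?thesis
    using wip_self[of M x] assms by (simp add: wnorm_def spd_def)
qed

lemma wnorm_pos:
  assumes "spd M" "x \<noteq> 0"
  shows "0 < wnorm M x"
proof -
  let ?p = "\<chi> i. Re (x $ i)" and ?q = "\<chi> i. Im (x $ i)"
  have nn: "0 \<le> y \<bullet> (M *v y)" for y
    using assms by (cases "y = 0") (auto simp: spd_def less_imp_le)
  have "?p \<noteq> 0 \<or> ?q \<noteq> 0"
    using assms(2) by (auto simp: vec_eq_iff complex_eq_iff)
  then have "0 < ?p \<bullet> (M *v ?p) + ?q \<bullet> (M *v ?q)"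
    using assms(1) nn[of ?p] nn[of ?q] unfolding spd_def
    by (metis add_nonneg_pos add_pos_nonneg)
  then show ?thesis
    using wip_self[of M x] assms(1) by (simp add: wnorm_def spd_def)
qed

lemma wnorm_nonneg: "spd M \<Longrightarrow> 0 \<le> wnorm M x"
  using wnorm_pos[of M x] by (cases "x = 0") (auto simp: wnorm_def wip_def)

section \<open>Finiteness of the operator norm\<close>

lemma wnorm_scale: "wnorm M (k *\<^sub>R x) = \<bar>k\<bar> * wnorm M x"
proof -
  have "cmat M *v (k *\<^sub>R x) = k *\<^sub>R (cmat M *v x)"
    by (simp add: vec_eq_iff matrix_vector_mult_def scaleR_sum_right)
  then have "wip M (k *\<^sub>R x) (k *\<^sub>R x) = of_real (k\<^sup>2) * wip M x x"
    unfolding wip_def by (simp add: sum_distrib_left power2_eq_square scaleR_conv_of_real[where 'a=complex] algebra_simps)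
  then show ?thesis
    by (simp add: wnorm_def real_sqrt_mult del: of_real_power)
qed

lemma continuous_on_wnorm_mult: "continuous_on S (\<lambda>x. wnorm M (K *v x))"
  unfolding wnorm_def wip_def matrix_vector_mult_def
  by (intro continuous_intros)

text \<open>A real \<open>Sup\<close> can be used as an upper bound only for a bounded set. By
  homogeneity every quotient is already taken on the Euclidean unit sphere, which is compact, and
  the quotient is continuous there.\<close>

lemma opnorm_bdd_above:
  fixes K :: "complex^'n^'m"
  assumes "spd Mu"
  shows "bdd_above {wnorm Mv (K *v x) / wnorm Mu x | x. x \<noteq> 0}"
proof -
  let ?f = "\<lambda>x. wnorm Mv (K *v x) / wnorm Mu x"
  have "continuous_on (sphere 0 1) ?f"
  proof (intro continuous_on_divide continuous_on_wnorm_mult ballI)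
    show "continuous_on (sphere 0 1) (wnorm Mu)"
      using continuous_on_wnorm_mult[of "sphere 0 1" Mu "mat 1 :: complex^'n^'n"] by simp
    show "wnorm Mu x \<noteq> 0" if "x \<in> sphere 0 1" for x
      using that wnorm_pos[OF assms, of x] by force
  qed
  then have "compact (?f ` sphere 0 1)"
    by (intro compact_continuous_image) auto
  then have bdd: "bdd_above (?f ` sphere 0 1)"
    by (simp add: bounded_imp_bdd_above compact_imp_bounded)
  have "?f x \<in> ?f ` sphere 0 1" if "x \<noteq> 0" for x :: "complex^'n"
  proof
    let ?y = "inverse (norm x) *\<^sub>R x"
    show "?y \<in> sphere 0 1"
      using that by simp
    have "K *v ?y = inverse (norm x) *\<^sub>R (K *v x)"
      by (simp add: vec_eq_iff matrix_vector_mult_def scaleR_sum_right)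
    then show "?f x = ?f ?y"
      using that by (simp add: wnorm_scale)
  qed
  then have "{?f x | x. x \<noteq> 0} \<subseteq> ?f ` sphere 0 1"
    by blast
  with bdd show ?thesis
    by (rule bdd_above_mono)
qed

lemma wnorm_mult_le_opnorm:
  assumes "spd Mu" "x \<noteq> 0"
  shows "wnorm Mv (K *v x) \<le> opnorm Mu Mv K * wnorm Mu x"
proof -
  have "wnorm Mv (K *v x) / wnorm Mu x \<le> opnorm Mu Mv K"
    unfolding opnorm_def using assms
    by (intro cSup_upper opnorm_bdd_above) auto
  then show ?thesis
    using wnorm_pos[OF assms] by (simp add: divide_le_eq)
qed

section \<open>Removing the square root from the field of values\<close>

lemma wspd_invertible:
  assumes "wspd M X"
  shows "invertible X"
proof -
  have "x = 0" if "X *v x = 0" for x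
    using assms that unfolding wspd_def by (force simp: wip_def)
  then show ?thesis
    by (simp add: invertible_left_inverse matrix_left_invertible_ker)
qed

text \<open>After substituting \<open>x = X *v y\<close>, self-adjointness moves one
  \<open>X\<close> to the other argument. There it cancels the outer inverse in the numerator and
  completes \<open>X ** X = B\<close> in the denominator.\<close>

lemma field_of_values_sqrt_congruence:
  assumes "is_pd_sqrt M X B" "z \<in> field_of_values M (matrix_inv X ** A ** matrix_inv X)"
  obtains y where "y \<noteq> 0" "z = wip M y (A *v y) / wip M y (B *v y)"
proof -
  obtain x where x: "x \<noteq> 0"
    and z: "z = wip M x ((matrix_inv X ** A ** matrix_inv X) *v x) / wip M x x"
    using assms(2) by (auto simp: field_of_values_def)
  have X: "wspd M X" "X ** X = B"
    using assms(1) by (auto simp: is_pd_sqrt_def)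
  have adj: "wip M (X *v u) v = wip M u (X *v v)" for u v
    using X(1) by (auto simp: wspd_def)
  have inv: "X ** matrix_inv X = mat 1" "matrix_inv X ** X = mat 1"
    using someI_ex[OF wspd_invertible[OF X(1), unfolded invertible_def]]
    unfolding matrix_inv_def by auto
  define y where "y = matrix_inv X *v x"
  have xy: "x = X *v y"
    by (simp add: y_def matrix_vector_mul_assoc inv)
  have "wip M x ((matrix_inv X ** A ** matrix_inv X) *v x) = wip M y (X *v (matrix_inv X *v (A *v y)))"
    by (metis adj matrix_vector_mul_assoc xy y_def)
  then have "wip M x ((matrix_inv X ** A ** matrix_inv X) *v x) = wip M y (A *v y)"
    by (simp add: matrix_vector_mul_assoc inv matrix_mul_assoc)
  moreover have "wip M x x = wip M y (B *v y)"
    by (metis X(2) adj matrix_vector_mul_assoc xy)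
  moreover have "y \<noteq> 0"
    using x xy by auto
  ultimately show thesis
    using that z by simp
qed

section \<open>Parallelograms and the regions Q, R and S\<close>

lemma parallelogram_in_hull:
  fixes p v w :: "'a::real_vector"
  assumes s: "0 \<le> s" "s \<le> S" and r: "0 \<le> r" "r \<le> R"
  shows "p + s *\<^sub>R v + r *\<^sub>R w \<in> convex hull {p, p + R *\<^sub>R w, p + S *\<^sub>R v, p + S *\<^sub>R v + R *\<^sub>R w}"
    (is "_ \<in> ?H")
proof -
  \<comment> \<open>This is applied twice along \<open>v\<close>, on the two opposite sides, and
    then once along \<open>w\<close> between the points obtained. For \<open>m = 0\<close> the
    bounds force \<open>k = 0\<close>.\<close>
  have interp: "x + k *\<^sub>R y \<in> ?H" if "x \<in> ?H" "x + m *\<^sub>R y \<in> ?H" "0 \<le> k" "k \<le> m" for x y k m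
  proof (cases "m = 0")
    case False
    have "x + k *\<^sub>R y = (1 - k / m) *\<^sub>R x + (k / m) *\<^sub>R (x + m *\<^sub>R y)"
      using False by (simp add: algebra_simps)
    also have "\<dots> \<in> ?H"
      using that False by (intro convexD[OF convex_convex_hull]) auto
    finally show ?thesis .
  qed (use that in auto)
  have vertex: "x \<in> ?H" if "x \<in> {p, p + R *\<^sub>R w, p + S *\<^sub>R v, p + S *\<^sub>R v + R *\<^sub>R w}" for x
    using that by (rule hull_inc)
  have "p + s *\<^sub>R v \<in> ?H"
    by (rule interp[of _ S]) (use s vertex in auto)
  moreover have "(p + R *\<^sub>R w) + s *\<^sub>R v \<in> ?H"
    by (rule interp[of _ S]) (use s vertex in \<open>auto simp: algebra_simps\<close>)
  ultimately show ?thesis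
    using interp[of "p + s *\<^sub>R v" R w r] r by (simp add: algebra_simps)
qed

text \<open>Q is the parallelogram based at 1 with edges \<open>\<alpha>/\<gamma> - 1\<close> and
  \<open>lc\<^sup>2 * \<alpha>\<close>; its far vertex is
  \<open>\<alpha>/\<gamma> + lc\<^sup>2 * \<alpha>\<close>.\<close>

lemma region_Q_I:
  assumes "0 < \<gamma>" "0 \<le> s" "s \<le> 1" "0 \<le> r" "r \<le> lc\<^sup>2"
  shows "1 + of_real s * (\<alpha> / of_real \<gamma> - 1) + of_real r * \<alpha> \<in> region_Q \<alpha> \<gamma> lc"
  using parallelogram_in_hull[OF assms(2-5), of 1 "\<alpha> / of_real \<gamma> - 1" \<alpha>] \<open>0 < \<gamma>\<close>
  by (simp add: region_Q_def Gam_def scaleR_conv_of_real field_simps)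

text \<open>The vertices of the smaller region are the points with \<open>s\<close> in {0, 1} and
  \<open>r\<close> in {0, \<open>l\<^sup>2\<close>} of the larger parallelogram.\<close>

lemma region_Q_mono:
  assumes "0 < \<gamma>" "0 \<le> l" "l \<le> l'"
  shows "region_Q \<alpha> \<gamma> l \<subseteq> region_Q \<alpha> \<gamma> l'"
proof -
  have "l\<^sup>2 \<le> l'\<^sup>2"
    using assms by (simp add: power_mono)
  then show ?thesis
    using region_Q_I[of \<gamma> 0 0 l' \<alpha>] region_Q_I[of \<gamma> 0 "l\<^sup>2" l' \<alpha>]
      region_Q_I[of \<gamma> 1 0 l' \<alpha>] region_Q_I[of \<gamma> 1 "l\<^sup>2" l' \<alpha>] \<open>0 < \<gamma>\<close>
    unfolding region_Q_def[of _ _ l]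
    by (intro hull_minimal) (auto simp: Gam_def field_simps region_Q_def convex_convex_hull)
qed

text \<open>The segments in the real case are the two diagonals of the parallelogram Q.\<close>

lemma region_S_subset_region_Q: "region_S \<alpha> \<gamma> lc lf \<subseteq> region_Q \<alpha> \<gamma> lc"
proof -
  have "convex hull {\<alpha> / of_real \<gamma>, Gam \<alpha> lc} \<subseteq> region_Q \<alpha> \<gamma> lc"
    "convex hull {1, \<alpha> / of_real \<gamma> * Gam (of_real \<gamma>) lc} \<subseteq> region_Q \<alpha> \<gamma> lc"
    unfolding region_Q_def by (rule hull_mono; blast)+
  then show ?thesis
    by (simp add: region_S_def segment_convex_hull)
qed

lemma zero_notin_region_Q:
  assumes "\<alpha> \<noteq> 0" "\<alpha> \<notin> complex_of_real ` {..<0}" "0 < \<gamma>"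
  shows "0 \<notin> region_Q \<alpha> \<gamma> lc"
proof -
  \<comment> \<open>The principal root bisects the angle between 1 and \<alpha>. Off the negative
    axis this angle is less than pi, so both have positive inner product with
    \<open>d\<close>.\<close>
  define d where "d = csqrt \<alpha>"
  have \<alpha>: "\<alpha> = d\<^sup>2"
    by (simp add: d_def)
  have "Re d \<noteq> 0"
  proof
    assume "Re d = 0"
    then have "\<alpha> = of_real (- (Im d)\<^sup>2)"
      by (simp add: \<alpha> complex_eq_iff power2_eq_square)
    moreover from this have "- (Im d)\<^sup>2 < 0"
      using assms(1) by auto
    ultimately show False
      using assms(2) by blast
  qed
  then have 1: "0 < d \<bullet> 1"
    using csqrt_principal[of \<alpha>] by (auto simp: d_def)
  have "d \<bullet> \<alpha> = (cmod d)\<^sup>2 * Re d"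
    unfolding \<alpha> inner_complex_def cmod_power2 by (simp add: power2_eq_square algebra_simps)
  moreover have "d \<noteq> 0"
    using 1 by auto
  ultimately have 2: "0 < d \<bullet> \<alpha>"
    using 1 by simp
  \<comment> \<open>Every vertex of Q is a nonnegative, nontrivial combination of 1 and
    \<alpha>.\<close>
  have comb: "0 < d \<bullet> (of_real s + of_real r * \<alpha>)" if "0 \<le> s" "0 \<le> r" "0 < s + r" for s r
  proof -
    have "d \<bullet> (of_real s + of_real r * \<alpha>) = s * (d \<bullet> 1) + r * (d \<bullet> \<alpha>)"
      by (simp add: inner_complex_def algebra_simps)
    then show ?thesis
      using that 1 2 by (metis add_nonneg_pos add_pos_nonneg add_0 less_le mult_nonneg_nonneg mult_pos_pos)
  qed
  have "region_Q \<alpha> \<gamma> lc \<subseteq> {z. 0 < d \<bullet> z}"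
    unfolding region_Q_def
    using 1 comb[of 1 "lc\<^sup>2"] comb[of 0 "1 / \<gamma>"] comb[of 0 "1 / \<gamma> + lc\<^sup>2"] \<open>0 < \<gamma>\<close>
    by (intro hull_minimal) (auto simp: Gam_def convex_halfspace_gt field_simps add_pos_nonneg)
  then show ?thesis
    by auto
qed

lemma fine_mesh_independentI:
  assumes "\<alpha> \<noteq> 0" "\<alpha> \<notin> complex_of_real ` {..<0}" "0 < \<gamma>"
  shows "fine_mesh_independent \<alpha> \<gamma> \<kappa>"
  unfolding fine_mesh_independent_def
\<comment> \<open>The witness is Q for the largest admissible coarse norm \<kappa>; it does not
  involve \<open>lf\<close>.\<close>
proof (intro conjI impI exI[of _ "region_Q \<alpha> \<gamma> \<kappa>"] allI)
  show "convex (region_Q \<alpha> \<gamma> \<kappa>)" "compact (region_Q \<alpha> \<gamma> \<kappa>)"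
    by (auto simp: region_Q_def convex_convex_hull finite_imp_compact_convex_hull)
  show "0 \<notin> region_Q \<alpha> \<gamma> \<kappa>"
    by (rule zero_notin_region_Q[OF assms])
next
  fix lc lf :: real
  assume "0 \<le> lc \<and> lc \<le> \<kappa> \<and> 0 \<le> lf"
  then show "region_S \<alpha> \<gamma> lc lf \<subseteq> region_Q \<alpha> \<gamma> \<kappa>"
    using region_S_subset_region_Q region_Q_mono[OF assms(3)] by blast
qed (simp add: region_S_def)

text \<open>R is again a parallelogram based at 1, now with directions
  \<open>\<alpha>/\<gamma> - 1\<close> and 1. The bound on \<open>s\<close> is
  \<open>Gam \<gamma> lc - 1 / Gam \<gamma> lf\<close>.\<close>

lemma region_R_I:
  assumes "0 < \<gamma>" "0 \<le> s" "s \<le> 1 + \<gamma> * lc\<^sup>2 - 1 / (1 + \<gamma> * lf\<^sup>2)" "0 \<le> r" "r \<le> \<gamma> * lc\<^sup>2"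
  shows "1 + of_real s * (\<alpha> / of_real \<gamma> - 1) + of_real r \<in> region_R \<alpha> \<gamma> lc lf"
  using parallelogram_in_hull[OF assms(2-5), of 1 "\<alpha> / of_real \<gamma> - 1" 1]
  by (simp add: region_R_def Gam_def scaleR_conv_of_real algebra_simps)

lemma of_real_in_closed_segment:
  assumes "l \<le> x" "x \<le> u"
  shows "complex_of_real x \<in> closed_segment (of_real l) (of_real u)"
  using assms by (simp add: closed_segment_of_real closed_segment_eq_real_ivl)

lemma quotient_in_region_S:
  assumes \<alpha>: "\<alpha> \<noteq> 0" "\<alpha> \<notin> complex_of_real ` {..<0}" and \<gamma>: "0 < \<gamma>"
    and a: "0 \<le> a" "a \<le> lc\<^sup>2" and b: "0 \<le> b" "b \<le> lf\<^sup>2"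
  shows "(1 + \<alpha> * of_real (a + b)) / (1 + of_real \<gamma> * of_real b) \<in> region_S \<alpha> \<gamma> lc lf"
    (is "?z \<in> _")
proof -
  define t where "t = 1 / (1 + \<gamma> * b)"
  have pos: "0 < 1 + \<gamma> * b"
    using \<gamma> b(1) by (simp add: add_pos_nonneg)
  have t: "0 < t" "t \<le> 1"
    using pos \<gamma> b by (auto simp: t_def field_simps)
  have "\<gamma> * b \<le> \<gamma> * lf\<^sup>2"
    using \<gamma> b by (simp add: mult_left_mono)
  \<comment> \<open>This bounds \<open>1 - t\<close> from above and so produces the term
    \<open>1 / Gam \<gamma> lf\<close> in R.\<close>
  then have t_ge: "1 / (1 + \<gamma> * lf\<^sup>2) \<le> t"
    unfolding t_def using pos by (intro frac_le) auto
  have ta: "0 \<le> t * a" "t * a \<le> lc\<^sup>2"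
    using t a mult_mono[of t 1 a "lc\<^sup>2"] by auto
  have "t * (1 + \<gamma> * b) = 1"
    using pos by (simp add: t_def)
  \<comment> \<open>Eliminating \<open>b\<close> makes the quotient affine in \<open>t\<close> and
    \<open>t * a\<close>.\<close>
  then have tb: "t * b = (1 - t) / \<gamma>"
    using \<gamma> by (simp add: field_simps)
  have "?z = of_real t * (1 + \<alpha> * of_real (a + b))"
    by (simp add: t_def)
  also have "\<dots> = of_real t + \<alpha> * of_real (t * a) + \<alpha> * of_real (t * b)"
    by (simp add: algebra_simps)
  also have "\<dots> = 1 + of_real (1 - t) * (\<alpha> / of_real \<gamma> - 1) + of_real (t * a) * \<alpha>"
    unfolding tb using \<gamma> by (simp add: field_simps)
  finally have z: "?z = 1 + of_real (1 - t) * (\<alpha> / of_real \<gamma> - 1) + of_real (t * a) * \<alpha>" .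
  show ?thesis
  proof (cases "Im \<alpha> = 0")
    case False
    have "?z \<in> region_Q \<alpha> \<gamma> lc"
      unfolding z using t ta \<gamma> by (intro region_Q_I) auto
    moreover have "?z \<in> region_R \<alpha> \<gamma> lc lf"
    proof -
      \<comment> \<open>The identity
        \<open>\<alpha> = \<gamma> * (\<alpha>/\<gamma> - 1) + \<gamma>\<close> exchanges the edge
        direction \<alpha> of Q for the direction 1 of R.\<close>
      have "?z = 1 + of_real (1 - t + \<gamma> * (t * a)) * (\<alpha> / of_real \<gamma> - 1) + of_real (\<gamma> * (t * a))"
        unfolding z using \<gamma> by (simp add: field_simps)
      also have "\<dots> \<in> region_R \<alpha> \<gamma> lc lf"
      proof -
        have "0 \<le> \<gamma> * (t * a)" "\<gamma> * (t * a) \<le> \<gamma> * lc\<^sup>2"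
          using \<gamma> ta by (auto intro: mult_left_mono)
        then show ?thesis
          using t t_ge \<gamma> by (intro region_R_I) linarith+
      qed
      finally show ?thesis .
    qed
    ultimately show ?thesis
      using False by (simp add: region_S_def)
  next
    case True
    define k where "k = Re \<alpha>"
    have k: "\<alpha> = of_real k"
      using True by (simp add: k_def complex_eq_iff)
    have "0 < k"
      using \<alpha> unfolding k by (metis imageI lessThan_iff linorder_neqE_linordered_idom of_real_0)
    define q where "q = k / \<gamma>"
    have z': "?z = of_real (1 + (1 - t) * (q - 1) + t * a * k)"
      unfolding z by (simp add: k q_def)
    have tak: "0 \<le> t * a * k" "t * a * k \<le> lc\<^sup>2 * k"
      using ta \<open>0 < k\<close> by (auto intro: mult_right_mono)
    show ?thesis
    proof (cases "k \<le> \<gamma>")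
      case le: True
      \<comment> \<open>The distances of the quotient to the end points are
        \<open>t * (1 - q) + t * a * k\<close> and
        \<open>(1 - t) * (1 - q) + (k * lc\<^sup>2 - t * a * k)\<close>. For \<open>q > 1\<close>
        the other diagonal gives the analogous sums with \<open>q - 1\<close>.\<close>
      then have "0 \<le> t * (1 - q)" "0 \<le> (1 - t) * (1 - q)"
        using t \<gamma> by (auto simp: q_def intro!: mult_nonneg_nonneg)
      then have "q \<le> 1 + (1 - t) * (q - 1) + t * a * k"
        "1 + (1 - t) * (q - 1) + t * a * k \<le> 1 + k * lc\<^sup>2"
        using tak by (simp_all add: algebra_simps)
      from of_real_in_closed_segment[OF this] show ?thesis
        unfolding z' using le by (simp add: region_S_def k Gam_def q_def)
    next
      case gt: False
      then have "0 \<le> t * (q - 1)" "0 \<le> (1 - t) * (q - 1)"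
        using t \<gamma> by (auto simp: q_def intro!: mult_nonneg_nonneg)
      then have "1 \<le> 1 + (1 - t) * (q - 1) + t * a * k"
        "1 + (1 - t) * (q - 1) + t * a * k \<le> q + k * lc\<^sup>2"
        using tak by (simp_all add: algebra_simps)
      moreover have "q + k * lc\<^sup>2 = k / \<gamma> * (1 + \<gamma> * lc\<^sup>2)"
        using \<gamma> by (simp add: q_def field_simps)
      ultimately have "?z \<in> closed_segment (of_real 1) (of_real (k / \<gamma> * (1 + \<gamma> * lc\<^sup>2)))"
        unfolding z' by (intro of_real_in_closed_segment) simp_all
      then show ?thesis
        using gt by (simp add: region_S_def k Gam_def)
    qed
  qed
qed

section \<open>From the matrices to the scalar quotient\<close>

lemma wip_identity_minus:
  "wip M y ((mat 1 - mat k ** X) *v y) = wip M y y - k * wip M y (X *v y)"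
proof -
  have "(mat 1 - mat k ** X) *v y = y - k *s (X *v y)"
    by (metis mat_vector_mult matrix_vector_mul_assoc matrix_vector_mul_lid
        matrix_vector_mult_diff_rdistrib)
  then show ?thesis
    by (simp add: wip_diff_right wip_scale_right)
qed

text \<open>Adjointness turns the quadratic form of the product into minus a squared norm, which is
  why \<open>a\<close> and \<open>b\<close> are real and nonnegative.\<close>

lemma wip_normal_product:
  assumes "spd Mv"
    and "\<And>u v. wip Mv (cmat K *v u) v = - wip Mu u (cmat L *v v)"
  shows "wip Mu y ((cmat L ** cmat K) *v y) = - of_real ((wnorm Mv (cmat K *v y))\<^sup>2)"
proof -
  have "wip Mu y (cmat L *v (cmat K *v y)) = - wip Mv (cmat K *v y) (cmat K *v y)"
    using assms(2) by simp
  then show ?thesis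
    by (simp add: matrix_vector_mul_assoc wip_self_eq_wnorm[OF assms(1)])
qed

theorem theorem4p3:
  fixes Mu :: "real^'u^'u" and Mv :: "real^'v^'v"
    and Lu Luf Luc :: "real^'u^'v"
    and Lv Lvf Lvc :: "real^'v^'u"
    and c h\<^sub>c \<gamma> :: real and \<alpha> :: complex
    and A B Bhalf Atilde :: "complex^'u^'u"
  assumes Mu: "spd Mu" and Mv: "spd Mv"
    and split_u: "Lu = Luf + Luc" and split_v: "Lv = Lvf + Lvc"
    and hc: "0 < h\<^sub>c"
    and bound_u: "opnorm Mu Mv (cmat Luc) \<le> c * inverse h\<^sub>c"
    and bound_v: "opnorm Mv Mu (cmat Lvc) \<le> c * inverse h\<^sub>c"
    and adj: "\<And>u v. wip Mv (cmat Lu *v u) v = - wip Mu u (cmat Lv *v v)"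
    and adj_c: "\<And>u v. wip Mv (cmat Luc *v u) v = - wip Mu u (cmat Lvc *v v)"
    and adj_f: "\<And>u v. wip Mv (cmat Luf *v u) v = - wip Mu u (cmat Lvf *v v)"
    and prod_c: "Lvc ** Luc = Lvc ** Lu"
    and prod_f: "Lvf ** Luf = Lvf ** Lu"
    and alpha: "\<alpha> \<noteq> 0" "\<alpha> \<notin> complex_of_real ` {..<0}"
    and gamma: "0 < \<gamma>"
    and A: "A = mat 1 - mat \<alpha> ** (cmat Lv ** cmat Lu)"
    and B: "B = mat 1 - mat (of_real \<gamma>) ** (cmat Lvf ** cmat Luf)"
    and Bhalf: "is_pd_sqrt Mu Bhalf B"
    and Atilde: "Atilde = matrix_inv Bhalf ** A ** matrix_inv Bhalf"
  shows "field_of_values Mu Atilde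
           \<subseteq> region_S \<alpha> \<gamma> (opnorm Mu Mv (cmat Luc)) (opnorm Mu Mv (cmat Luf))
       \<and> fine_mesh_independent \<alpha> \<gamma> (c * inverse h\<^sub>c)
       \<and> 0 \<notin> region_S \<alpha> \<gamma> (opnorm Mu Mv (cmat Luc)) (opnorm Mu Mv (cmat Luf))"
proof (intro conjI subsetI)
  let ?lc = "opnorm Mu Mv (cmat Luc)" and ?lf = "opnorm Mu Mv (cmat Luf)"
  show "0 \<notin> region_S \<alpha> \<gamma> ?lc ?lf"
    using region_S_subset_region_Q zero_notin_region_Q[OF alpha gamma] by blast
  show "fine_mesh_independent \<alpha> \<gamma> (c * inverse h\<^sub>c)"
    by (rule fine_mesh_independentI[OF alpha gamma])
  fix z
  assume "z \<in> field_of_values Mu Atilde"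
  then obtain y where y: "y \<noteq> 0" and z: "z = wip Mu y (A *v y) / wip Mu y (B *v y)"
    unfolding Atilde using field_of_values_sqrt_congruence[OF Bhalf] by metis
  define n where "n = (wnorm Mu y)\<^sup>2"
  define a where "a = (wnorm Mv (cmat Luc *v y))\<^sup>2 / n"
  define b where "b = (wnorm Mv (cmat Luf *v y))\<^sup>2 / n"
  have n: "0 < n"
    using wnorm_pos[OF Mu y] by (simp add: n_def)
  have wyy: "wip Mu y y = of_real n"
    by (simp add: n_def wip_self_eq_wnorm[OF Mu])
  have c: "wip Mu y ((cmat Lvc ** cmat Luc) *v y) = - of_real (a * n)"
    using wip_normal_product[OF Mv adj_c] n by (simp add: a_def)
  have f: "wip Mu y ((cmat Lvf ** cmat Luf) *v y) = - of_real (b * n)"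
    using wip_normal_product[OF Mv adj_f] n by (simp add: b_def)
  \<comment> \<open>The split products remove the mixed terms: both \<open>Lvc ** Lu\<close> and
    \<open>Lvf ** Lu\<close> keep only their own part of \<open>Lu\<close>.\<close>
  have "Lv ** Lu = Lvc ** Luc + Lvf ** Luf"
    unfolding prod_c prod_f
    by (simp add: split_v vec_eq_iff matrix_matrix_mult_def algebra_simps sum.distrib)
  then have LvLu: "cmat Lv ** cmat Lu = cmat Lvc ** cmat Luc + cmat Lvf ** cmat Luf"
    by (simp flip: cmat_mult cmat_add)
  have "wip Mu y (A *v y) = of_real n * (1 + \<alpha> * of_real (a + b))"
    unfolding A LvLu wip_identity_minus matrix_vector_mult_add_rdistrib wip_add_right wyy c f
    by (simp add: algebra_simps)
  moreover have "wip Mu y (B *v y) = of_real n * (1 + of_real \<gamma> * of_real b)"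
    unfolding B wip_identity_minus wyy f by (simp add: algebra_simps)
  ultimately have z': "z = (1 + \<alpha> * of_real (a + b)) / (1 + of_real \<gamma> * of_real b)"
    using n by (simp add: z)
  \<comment> \<open>Applied to the coarse and the fine part, this gives
    \<open>a \<le> lc\<^sup>2\<close> and \<open>b \<le> lf\<^sup>2\<close>.\<close>
  have bound: "(wnorm Mv (K *v y))\<^sup>2 / n \<le> (opnorm Mu Mv K)\<^sup>2" for K
    using power_mono[OF wnorm_mult_le_opnorm[OF Mu y, of Mv K] wnorm_nonneg[OF Mv], of 2] n
    by (simp add: n_def divide_le_eq power_mult_distrib)
  show "z \<in> region_S \<alpha> \<gamma> ?lc ?lf"
    unfolding z' using n bound
    by (intro quotient_in_region_S alpha gamma) (simp_all add: a_def b_def)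
qed

end
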